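(* Let $[a,b]\subset\mathbb{R}$ be a compact interval, let $n$ be a positive integer, and let $f:[a,b]\to\mathbb{R}$ be such that $f^{(n)}$ exists and is continuous on $[a,b]$. Put $$P_n(x)=\sum_{k=0}^n\frac{f^{(k)}(a)(x-a)^k}{k!},\qquad R_n(x)=f(x)-P_n(x)\qquad(x\in[a,b]).$$ Then $$\|R_n\|\leq \frac{(b-a)^{n+1}}{(n+1)!}\|f^{(n+1)}\|=\frac{(b-a)^{n+1}}{(n+1)!}\max_{a\leq x\leq b}|f^{(n)}(x)-f^{(n)}(a)|,$$ where $\|\cdot\|$ is the Alexiewicz norm on $[a,b]$ and $f^{(n+1)}$ denotes the distributional derivative of the continuous function $f^{(n)}$.
   Context: Derivatives at the endpoints $a,b$ are one-sided. Alexiewicz norm: for an integrable function $g$ on $[a,b]$ (Henstock--Kurzweil integrable in general; for continuous $g$ such as $R_n$ the Riemann integral suffices), $\|g\|=\sup_{a\le x\le b}\left|\int_a^x g\right|$. The Alexiewicz norm extends to the completion of the space of Henstock--Kurzweil integrable functions on $[a,b]$, which is the space of Schwartz distributions $g$ that are distributional derivatives of continuous functions: there is a continuous function $F:[a,b]\to\mathbb{R}$ with $F(a)=0$ and $g(\phi)=-\int_a^b F\phi'$ for all test functions $\phi\in\mathcal{D}=\{\phi:[a,b]\to\mathbb{R}\mid \phi\in C^\infty,\ \mathrm{supp}(\phi)\subset(a,b)\}$. For such $g$, the norm is $\|g\|=\max_{x\in[a,b]}|F(x)|=\|F\|_\infty$. *)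

theory Defs
  imports "HOL-Analysis.Analysis"
begin

definition maximum_on :: "'a set \<Rightarrow> ('a \<Rightarrow> real) \<Rightarrow> real" where
  "maximum_on S h = (GREATEST y. y \<in> h ` S)"

text \<open>
  Derivatives are taken within the interval, hence are one-sided at the endpoints;
  the values of \<open>f\<close> outside \<open>{a..b}\<close> are irrelevant.
\<close>

primrec nth_deriv_on :: "real \<Rightarrow> real \<Rightarrow> nat \<Rightarrow> (real \<Rightarrow> real) \<Rightarrow> real \<Rightarrow> real" where
  "nth_deriv_on a b 0 f = f"
| "nth_deriv_on a b (Suc k) f =
     (\<lambda>x. vector_derivative (nth_deriv_on a b k f) (at x within {a..b}))"

definition nth_deriv_exists_on :: "real \<Rightarrow> real \<Rightarrow> nat \<Rightarrow> (real \<Rightarrow> real) \<Rightarrow> bool" where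
  "nth_deriv_exists_on a b n f \<longleftrightarrow> (\<forall>k<n. nth_deriv_on a b k f differentiable_on {a..b})"

definition taylor_poly :: "real \<Rightarrow> real \<Rightarrow> nat \<Rightarrow> (real \<Rightarrow> real) \<Rightarrow> real \<Rightarrow> real" where
  "taylor_poly a b n f x = (\<Sum>k=0..n. nth_deriv_on a b k f a * (x - a) ^ k / fact k)"

definition taylor_remainder :: "real \<Rightarrow> real \<Rightarrow> nat \<Rightarrow> (real \<Rightarrow> real) \<Rightarrow> real \<Rightarrow> real" where
  "taylor_remainder a b n f x = f x - taylor_poly a b n f x"

definition alexiewicz_norm :: "real \<Rightarrow> real \<Rightarrow> (real \<Rightarrow> real) \<Rightarrow> real" where
  "alexiewicz_norm a b g = (SUP x\<in>{a..b}. \<bar>integral {a..x} g\<bar>)"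

text \<open>
  A test function is identified with its extension by zero to the whole line, which is
  again smooth because its support is a compact subset of the open interval.
\<close>

definition test_functions :: "real \<Rightarrow> real \<Rightarrow> (real \<Rightarrow> real) set" where
  "test_functions a b =
     {\<phi>. (\<forall>k. (deriv ^^ k) \<phi> differentiable_on UNIV) \<and> closure {x. \<phi> x \<noteq> 0} \<subseteq> {a<..<b}}"

text \<open>
  Distributions are represented as functionals that are only ever evaluated on
  test functions.
\<close>

type_synonym distr = "(real \<Rightarrow> real) \<Rightarrow> real"

definition distr_deriv :: "real \<Rightarrow> real \<Rightarrow> (real \<Rightarrow> real) \<Rightarrow> distr" where
  "distr_deriv a b F = (\<lambda>\<phi>. - integral {a..b} (\<lambda>x. F x * deriv \<phi> x))"

definition is_primitive :: "real \<Rightarrow> real \<Rightarrow> (real \<Rightarrow> real) \<Rightarrow> distr \<Rightarrow> bool" where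
  "is_primitive a b F g \<longleftrightarrow>
     continuous_on {a..b} F \<and> F a = 0 \<and> (\<forall>\<phi>\<in>test_functions a b. g \<phi> = distr_deriv a b F \<phi>)"

text \<open>
  The Alexiewicz norm of a distribution that has a continuous primitive. The description
  is proper since such a primitive vanishing at \<open>a\<close> is unique on \<open>{a..b}\<close>.
\<close>

definition alexiewicz_norm_distr :: "real \<Rightarrow> real \<Rightarrow> distr \<Rightarrow> real" where
  "alexiewicz_norm_distr a b g =
     (THE r. \<exists>F. is_primitive a b F g \<and> r = maximum_on {a..b} (\<lambda>x. \<bar>F x\<bar>))"

end

theory Submission
  imports Defs
begin

text \<open>
  The integral form of the Taylor remainder with \<open>f\<^sup>(\<^sup>n\<^sup>)(a)\<close> subtracted bounds \<open>R\<^sub>n(x)\<close> by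
  \<open>M (x - a)\<^sup>n / n!\<close>, where \<open>M\<close> is the maximum of \<open>\<bar>f\<^sup>(\<^sup>n\<^sup>)(x) - f\<^sup>(\<^sup>n\<^sup>)(a)\<bar>\<close>; one further integration
  gives the estimate. That \<open>M\<close> is the norm of the distributional derivative requires the
  primitive to be unique, which is the lemma of du Bois-Reymond. It is proved by contradiction:
  if \<open>G c < G d\<close>, a test function built from two smooth steps located at \<open>c\<close> and \<open>d\<close> has a
  derivative that is not orthogonal to \<open>G\<close>.
\<close>

section \<open>A smooth step function\<close>

text \<open>
  Existential derivatives make the closure properties below direct inductions;
  \<open>deriv\<close> would have to be computed explicitly in each of them.
\<close>

primrec times_differentiable :: "nat \<Rightarrow> (real \<Rightarrow> real) \<Rightarrow> bool" where
  "times_differentiable 0 f \<longleftrightarrow> True"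
| "times_differentiable (Suc k) f \<longleftrightarrow>
     (\<exists>f'. (\<forall>x. (f has_real_derivative f' x) (at x)) \<and> times_differentiable k f')"

lemma times_differentiable_SucI:
  assumes "\<And>x. (f has_real_derivative f' x) (at x)" "times_differentiable k f'"
  shows "times_differentiable (Suc k) f"
  using assms by auto

lemma times_differentiable_SucD: "times_differentiable (Suc k) f \<Longrightarrow> times_differentiable k f"
proof (induction k arbitrary: f)
  case (Suc k)
  then obtain f' where "\<And>x. (f has_real_derivative f' x) (at x)" "times_differentiable (Suc k) f'"
    by (metis times_differentiable.simps(2))
  then show ?case
    using Suc.IH times_differentiable_SucI by blast
qed simp

lemma times_differentiable_const: "times_differentiable k (\<lambda>_. c)"
proof (induction k arbitrary: c)
  case (Suc k)
  show ?case
    by (rule times_differentiable_SucI[of _ "\<lambda>_. 0"]) (auto intro: Suc)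
qed simp

lemma times_differentiable_add:
  "times_differentiable k f \<Longrightarrow> times_differentiable k g \<Longrightarrow> times_differentiable k (\<lambda>x. f x + g x)"
proof (induction k arbitrary: f g)
  case (Suc k)
  then obtain f' g' where "\<And>x. (f has_real_derivative f' x) (at x)" "times_differentiable k f'"
    "\<And>x. (g has_real_derivative g' x) (at x)" "times_differentiable k g'"
    by auto
  then show ?case
    by (intro times_differentiable_SucI[of _ "\<lambda>x. f' x + g' x"] Suc.IH DERIV_add)
qed simp

lemma times_differentiable_mult:
  "times_differentiable k f \<Longrightarrow> times_differentiable k g \<Longrightarrow> times_differentiable k (\<lambda>x. f x * g x)"
proof (induction k arbitrary: f g)
  case (Suc k)
  \<comment> \<open>The product rule leaves one factor undifferentiated in each summand, so f and g
    themselves are needed at order k too.\<close>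
  note fg = Suc.prems[THEN times_differentiable_SucD]
  obtain f' g' where "\<And>x. (f has_real_derivative f' x) (at x)" "times_differentiable k f'"
    "\<And>x. (g has_real_derivative g' x) (at x)" "times_differentiable k g'"
    using Suc.prems by auto
  then show ?case using fg
    by (intro times_differentiable_SucI[of _ "\<lambda>x. f' x * g x + g' x * f x"]
        times_differentiable_add Suc.IH DERIV_mult)
qed simp

lemma times_differentiable_diff:
  assumes "times_differentiable k f" "times_differentiable k g"
  shows "times_differentiable k (\<lambda>x. f x - g x)"
  using times_differentiable_add[OF assms(1) times_differentiable_mult
      [OF times_differentiable_const[of k "-1"] assms(2)]]
  by simp

lemma times_differentiable_affine:
  "times_differentiable k f \<Longrightarrow> times_differentiable k (\<lambda>x. f (p * x + q))"
proof (induction k arbitrary: f)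
  case (Suc k)
  then obtain f' where f': "\<And>x. (f has_real_derivative f' x) (at x)" "times_differentiable k f'"
    by auto
  have "((\<lambda>x. f (p * x + q)) has_real_derivative f' (p * x + q) * p) (at x)" for x
    by (rule DERIV_chain'[of "\<lambda>x. p * x + q" p x UNIV f, OF _ f'(1), THEN DERIV_cong])
      (auto intro!: derivative_eq_intros)
  then show ?case
    by (rule times_differentiable_SucI
        [OF _ times_differentiable_mult[OF Suc.IH[OF f'(2)] times_differentiable_const]])
qed simp

text \<open>The derivative of 1 / f is -f' times the square of 1 / f. Only f' and 1 / f occur in it,
  so the induction runs over k for a fixed f.\<close>

lemma times_differentiable_inverse:
  assumes "\<And>x. f x \<noteq> 0"
  shows "times_differentiable k f \<Longrightarrow> times_differentiable k (\<lambda>x. inverse (f x))"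
proof (induction k)
  case (Suc k)
  then obtain f' where f': "\<And>x. (f has_real_derivative f' x) (at x)" "times_differentiable k f'"
    by auto
  have inv: "times_differentiable k (\<lambda>x. inverse (f x))"
    using Suc.IH Suc.prems times_differentiable_SucD by blast
  have "((\<lambda>x. inverse (f x)) has_real_derivative (- 1) * (f' x * (inverse (f x) * inverse (f x)))) (at x)"
    for x
    using DERIV_inverse_fun[OF f'(1)[of x] assms] by (simp add: mult_ac)
  then show ?case
    by (intro times_differentiable_SucI[OF _ times_differentiable_mult[OF times_differentiable_const
        times_differentiable_mult[OF f'(2) times_differentiable_mult[OF inv inv]]]])
qed simp

text \<open>Link to \<open>test_functions\<close>, where smoothness is expressed by iterating
  \<open>deriv\<close>. The order is \<open>Suc k\<close> because the k-th derivative must itself be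
  differentiable.\<close>

lemma times_differentiable_imp_deriv:
  "times_differentiable (Suc k) f \<Longrightarrow> (deriv ^^ k) f differentiable_on UNIV"
proof (induction k arbitrary: f)
  case 0
  then show ?case
    by (auto simp: differentiable_on_def real_differentiable_def)
next
  case (Suc k)
  obtain f' where f': "\<And>x. (f has_real_derivative f' x) (at x)" "times_differentiable (Suc k) f'"
    using Suc.prems by (metis times_differentiable.simps(2))
  have "deriv f = f'"
    using f'(1) DERIV_imp_deriv by blast
  then show ?case
    using Suc.IH[OF f'(2)] by (simp add: funpow_swap1)
qed

text \<open>Powers of 1 / x are carried along so that the span of the family is closed under
  differentiation; k = 0 is the classical smooth function that is flat at 0.\<close>

definition flat_exp :: "nat \<Rightarrow> real \<Rightarrow> real" where
  "flat_exp k x = (if x > 0 then exp (- inverse x) * inverse x ^ k else 0)"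

lemma flat_exp_deriv:
  "(flat_exp k has_real_derivative flat_exp (k + 2) x - real k * flat_exp (k + 1) x) (at x)"
proof -
  consider "x < 0" | "x = 0" | "x > 0" by linarith
  then show ?thesis
  proof cases
    case 1
    have "(flat_exp k has_real_derivative 0) (at x)"
      by (rule has_field_derivative_transform_within_open[of "\<lambda>_. 0" _ _ "{..<0}"])
        (use 1 in \<open>auto simp: flat_exp_def\<close>)
    with 1 show ?thesis by (simp add: flat_exp_def)
  next
    case 2
    have "((\<lambda>y. flat_exp k y / y) \<longlongrightarrow> 0) (at 0)"
    proof (rule filterlim_split_at)
      show "((\<lambda>y. flat_exp k y / y) \<longlongrightarrow> 0) (at_left 0)"
        by (rule tendsto_eventually) (auto simp: eventually_at_filter flat_exp_def)
      \<comment> \<open>Replacing y by 1 / y turns the right-hand difference quotient at 0 into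
        y^(k+1) / exp y at infinity.\<close>
      have "((\<lambda>y. flat_exp k (inverse y) / inverse y) \<longlongrightarrow> 0) at_top"
        by (rule Lim_transform_eventually[OF tendsto_power_div_exp_0[of "Suc k"]
              eventually_mono[OF eventually_gt_at_top[of 0]]])
          (simp add: flat_exp_def field_simps exp_minus)
      then show "((\<lambda>y. flat_exp k y / y) \<longlongrightarrow> 0) (at_right 0)"
        by (simp add: filterlim_at_right_to_top)
    qed
    with 2 show ?thesis
      by (simp add: has_field_derivative_iff flat_exp_def)
  next
    case 3
    have D: "((\<lambda>x. exp (- inverse x) * inverse x ^ k) has_real_derivative
      exp (- inverse x) * inverse x ^ 2 * inverse x ^ k
        - real k * inverse x ^ (k - 1) * inverse x ^ 2 * exp (- inverse x)) (at x)"
      using 3 by (auto intro!: derivative_eq_intros simp: algebra_simps power2_eq_square)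
    \<comment> \<open>The truncated \<open>k - 1\<close> is harmless at k = 0, since the factor k
      vanishes there.\<close>
    have eq: "real k * inverse x ^ (k - 1) * inverse x ^ 2 = real k * inverse x ^ (k + 1)"
      by (cases k) (simp_all add: power2_eq_square)
    have "((\<lambda>x. exp (- inverse x) * inverse x ^ k) has_real_derivative
      flat_exp (k + 2) x - real k * flat_exp (k + 1) x) (at x)"
      by (rule DERIV_cong[OF D]) (simp only: eq, use 3 in \<open>simp add: flat_exp_def power2_eq_square\<close>)
    then show ?thesis
      by (rule has_field_derivative_transform_within_open[of _ _ _ "{0<..}"])
        (use 3 in \<open>auto simp: flat_exp_def\<close>)
  qed
qed

lemma times_differentiable_flat_exp: "times_differentiable m (flat_exp k)"
proof (induction m arbitrary: k)
  case (Suc m)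
  have "times_differentiable m (\<lambda>x. flat_exp (k + 2) x - real k * flat_exp (k + 1) x)"
    by (rule times_differentiable_diff[OF Suc times_differentiable_mult[OF times_differentiable_const Suc]])
  then show ?case
    by (rule times_differentiable_SucI[rotated]) (rule flat_exp_deriv)
qed simp

text \<open>The standard smooth transition from 0 to 1 across the unit interval. It is written with
  \<open>inverse\<close> to match the closure lemmas for products and reciprocals.\<close>

definition smooth_step :: "real \<Rightarrow> real" where
  "smooth_step x = flat_exp 0 x * inverse (flat_exp 0 x + flat_exp 0 (1 - x))"

lemma flat_exp_nonneg: "flat_exp k x \<ge> 0"
  by (simp add: flat_exp_def)

text \<open>At least one of x and 1 - x is positive, so the denominator of
  \<open>smooth_step\<close> never vanishes.\<close>

lemma flat_exp_sum_pos: "flat_exp 0 x + flat_exp 0 (1 - x) > 0"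
  by (cases "x > 0"; cases "x < 1") (auto simp: flat_exp_def intro: add_pos_pos)

lemma times_differentiable_smooth_step: "times_differentiable k smooth_step"
proof -
  have "times_differentiable k (\<lambda>x. flat_exp 0 (1 - x))"
    using times_differentiable_affine[OF times_differentiable_flat_exp, of k 0 "-1" 1] by simp
  moreover have "flat_exp 0 x + flat_exp 0 (1 - x) \<noteq> 0" for x
    using flat_exp_sum_pos[of x] by simp
  ultimately show ?thesis
    unfolding smooth_step_def
    by (intro times_differentiable_mult times_differentiable_inverse times_differentiable_add
        times_differentiable_flat_exp)
qed

lemma smooth_step_eq_0: "x \<le> 0 \<Longrightarrow> smooth_step x = 0"
  by (simp add: smooth_step_def flat_exp_def)

lemma smooth_step_eq_1: "x \<ge> 1 \<Longrightarrow> smooth_step x = 1"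
  by (simp add: smooth_step_def flat_exp_def)

text \<open>The quotient rule after cancelling the product of \<open>flat_exp 2 x\<close> and
  \<open>flat_exp 0 x\<close>; in this form every remaining term is visibly nonnegative.\<close>

definition smooth_step' :: "real \<Rightarrow> real" where
  "smooth_step' x = (flat_exp 2 x * flat_exp 0 (1 - x) + flat_exp 0 x * flat_exp 2 (1 - x))
     / (flat_exp 0 x + flat_exp 0 (1 - x))\<^sup>2"

lemma smooth_step_deriv: "(smooth_step has_real_derivative smooth_step' x) (at x)"
proof -
  have d: "(flat_exp 0 has_real_derivative flat_exp 2 x) (at x)" for x
    using flat_exp_deriv[of 0 x] by (simp add: numeral_2_eq_2)
  have d': "((\<lambda>x. flat_exp 0 (1 - x)) has_real_derivative - flat_exp 2 (1 - x)) (at x)"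
    using DERIV_chain'[OF DERIV_diff[OF DERIV_const DERIV_ident] d, of 1 x] by simp
  have "(smooth_step has_real_derivative
     (flat_exp 2 x * (flat_exp 0 x + flat_exp 0 (1 - x))
       - flat_exp 0 x * (flat_exp 2 x + - flat_exp 2 (1 - x)))
      / ((flat_exp 0 x + flat_exp 0 (1 - x)) * (flat_exp 0 x + flat_exp 0 (1 - x)))) (at x)"
    unfolding smooth_step_def divide_inverse[symmetric]
    by (rule DERIV_divide[OF d DERIV_add[OF d d']]) (use flat_exp_sum_pos[of x] in simp)
  then show ?thesis
    by (rule DERIV_cong) (simp add: smooth_step'_def algebra_simps power2_eq_square)
qed

lemma smooth_step'_nonneg: "smooth_step' x \<ge> 0"
  by (simp add: smooth_step'_def flat_exp_nonneg)

lemma smooth_step'_pos: "0 < x \<Longrightarrow> x < 1 \<Longrightarrow> smooth_step' x > 0"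
  using flat_exp_sum_pos[of x]
  by (auto simp: smooth_step'_def flat_exp_def intro!: divide_pos_pos add_pos_pos)

lemma smooth_step'_eq_0: "x \<notin> {0<..<1} \<Longrightarrow> smooth_step' x = 0"
  by (auto simp: smooth_step'_def flat_exp_def)

section \<open>The fundamental lemma of the calculus of variations\<close>

text \<open>The support lies in the open interval, so the boundary values vanish. This is why adding
  a constant to a function does not change its distributional derivative.\<close>

lemma test_function_integral_deriv:
  assumes "a \<le> b" "\<phi> \<in> test_functions a b"
  shows "(deriv \<phi> has_integral 0) {a..b}"
proof -
  have "(deriv ^^ 0) \<phi> differentiable_on UNIV"
    using assms(2) unfolding test_functions_def by blast
  then have "(\<phi> has_real_derivative deriv \<phi> x) (at x)" for x
    by (simp add: differentiable_on_def DERIV_deriv_iff_real_differentiable)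
  then have "(deriv \<phi> has_integral \<phi> b - \<phi> a) {a..b}"
    using assms(1)
    by (intro fundamental_theorem_of_calculus)
      (auto simp: has_real_derivative_iff_has_vector_derivative[symmetric]
        intro: has_field_derivative_at_within)
  moreover have "\<phi> a = 0" "\<phi> b = 0"
    using assms(2) closure_subset[of "{x. \<phi> x \<noteq> 0}"] by (fastforce simp: test_functions_def)+
  ultimately show ?thesis by simp
qed

lemma continuous_on_deriv_test_function:
  assumes "\<phi> \<in> test_functions a b"
  shows "continuous_on S (deriv \<phi>)"
proof -
  have "(deriv ^^ 1) \<phi> differentiable_on UNIV"
    using assms unfolding test_functions_def by blast
  then show ?thesis
    using differentiable_imp_continuous_on continuous_on_subset by fastforce
qed

text \<open>A single step does not have compact support. In the difference of two steps of width h
  the values 0 cancel to the left of both steps and the values 1 to the right of both, whichever of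
  c and d comes first.\<close>

definition step_difference :: "real \<Rightarrow> real \<Rightarrow> real \<Rightarrow> real \<Rightarrow> real" where
  "step_difference c d h x = smooth_step ((x - d) / h) - smooth_step ((x - c) / h)"

lemma step_difference_deriv:
  "(step_difference c d h has_real_derivative
     (smooth_step' ((x - d) / h) - smooth_step' ((x - c) / h)) / h) (at x)"
proof -
  have "((\<lambda>x. (x - p) / h) has_real_derivative 1 / h) (at x)" for p
    by (auto intro!: derivative_eq_intros simp: divide_inverse)
  from DERIV_chain'[OF this smooth_step_deriv]
  have "((\<lambda>x. smooth_step ((x - p) / h)) has_real_derivative smooth_step' ((x - p) / h) / h) (at x)"
    for p
    by simp
  from DERIV_diff[OF this[of d] this[of c]] show ?thesis
    unfolding step_difference_def by (simp add: diff_divide_distrib)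
qed

lemma step_difference_test_function:
  assumes "h > 0" "a < c" "a < d" "c + h < b" "d + h < b"
  shows "step_difference c d h \<in> test_functions a b"
proof -
  have td: "times_differentiable k (\<lambda>x. smooth_step ((x - p) / h))" for k p
    using times_differentiable_affine[OF times_differentiable_smooth_step, of k "1 / h" "- p / h"]
    by (simp add: diff_divide_distrib)
  have "(deriv ^^ k) (step_difference c d h) differentiable_on UNIV" for k
    unfolding step_difference_def
    by (intro times_differentiable_imp_deriv times_differentiable_diff td)
  moreover have "{x. step_difference c d h x \<noteq> 0} \<subseteq> {min c d..max c d + h}"
  proof
    fix x assume x: "x \<in> {x. step_difference c d h x \<noteq> 0}"
    show "x \<in> {min c d..max c d + h}"
    proof (rule ccontr)
      assume "\<not> ?thesis"
      then consider "x < c" "x < d" | "x > c + h" "x > d + h" by fastforce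
      then have "step_difference c d h x = 0"
        using assms(1) by cases (auto simp: step_difference_def smooth_step_eq_0 smooth_step_eq_1
            field_simps)
      with x show False by simp
    qed
  qed
  then have "closure {x. step_difference c d h x \<noteq> 0} \<subseteq> {min c d..max c d + h}"
    by (rule closure_minimal) simp
  then have "closure {x. step_difference c d h x \<noteq> 0} \<subseteq> {a<..<b}"
    using assms by fastforce
  ultimately show ?thesis
    unfolding test_functions_def by blast
qed

text \<open>
  If \<open>G c < m < G d\<close>, the derivative of the difference of a step up at \<open>d\<close> and a step up at \<open>c\<close>
  has the sign of \<open>G - m\<close> wherever it does not vanish.
\<close>

lemma du_Bois_Reymond_not_less:
  assumes G: "continuous_on {a..b} G"
    and orth: "\<And>\<phi>. \<phi> \<in> test_functions a b \<Longrightarrow> integral {a..b} (\<lambda>x. G x * deriv \<phi> x) = 0"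
    and c: "a < c" "c < b" and d: "a < d" "d < b"
  shows "\<not> G c < G d"
proof
  assume less: "G c < G d"
  define m where "m = (G c + G d) / 2"
  have m: "G c < m" "m < G d" using less by (auto simp: m_def)
  have cont: "isCont G c" "isCont G d"
    using G c d by (auto intro!: continuous_on_interior)
  have "\<forall>\<^sub>F x in nhds c. G x < m" "\<forall>\<^sub>F x in nhds d. G x > m"
    using order_tendstoD[OF tendsto_at_iff_tendsto_nhds[THEN iffD1, OF cont(1)[unfolded isCont_def]]] m
      order_tendstoD[OF tendsto_at_iff_tendsto_nhds[THEN iffD1, OF cont(2)[unfolded isCont_def]]]
    by auto
  then obtain r s where r: "r > 0" "\<And>x. dist x c < r \<Longrightarrow> G x < m"
    and s: "s > 0" "\<And>x. dist x d < s \<Longrightarrow> G x > m"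
    unfolding eventually_nhds_metric by auto
  \<comment> \<open>Halving the minimum makes all bounds strict: each step stays inside the
    neighbourhood where the sign of G - m is known, and both are complete before b.\<close>
  define h where "h = Min {r, s, b - c, b - d} / 2"
  have "Min {r, s, b - c, b - d} > 0" using r s c d by simp
  then have h: "h > 0" "h < r" "h < s" "h < b - c" "h < b - d"
    unfolding h_def by auto
  define \<phi> where "\<phi> = step_difference c d h"
  have \<phi>: "\<phi> \<in> test_functions a b"
    unfolding \<phi>_def using h c d by (intro step_difference_test_function) auto
  have d\<phi>: "deriv \<phi> x = (smooth_step' ((x - d) / h) - smooth_step' ((x - c) / h)) / h" for x
    unfolding \<phi>_def by (rule DERIV_imp_deriv[OF step_difference_deriv])
  \<comment> \<open>A nonzero value would force c < x < c + h, hence dist x c < r and G x < m. The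
    step at d is treated symmetrically.\<close>
  have sc: "smooth_step' ((x - c) / h) = 0" if "G x \<ge> m" for x
    using r(2)[of x] that h by (intro smooth_step'_eq_0) (auto simp: dist_real_def field_simps)
  have sd: "smooth_step' ((x - d) / h) = 0" if "G x \<le> m" for x
    using s(2)[of x] that h by (intro smooth_step'_eq_0) (auto simp: dist_real_def field_simps)
  have nonneg: "(G x - m) * deriv \<phi> x \<ge> 0" for x
  proof (cases "G x \<ge> m")
    case True
    then show ?thesis using h smooth_step'_nonneg by (simp add: d\<phi> sc)
  next
    case False
    then show ?thesis using h smooth_step'_nonneg by (simp add: d\<phi> sd mult_nonpos_nonneg divide_nonpos_pos)
  qed
  have cont': "continuous_on {a..b} (\<lambda>x. (G x - m) * deriv \<phi> x)"
    using G \<phi> by (intro continuous_intros continuous_on_deriv_test_function)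
  have "(\<lambda>x. G x * deriv \<phi> x) integrable_on {a..b}"
    using G \<phi> by (intro integrable_continuous_real continuous_intros continuous_on_deriv_test_function)
  \<comment> \<open>G may be replaced by G - m, because \<open>deriv \<phi>\<close> has integral
    0.\<close>
  then have "((\<lambda>x. G x * deriv \<phi> x - m * deriv \<phi> x) has_integral 0 - m * 0) {a..b}"
    using c orth[OF \<phi>] by (intro has_integral_diff has_integral_mult_right
      test_function_integral_deriv \<phi>) (auto simp: has_integral_integral)
  then have "integral {a..b} (\<lambda>x. (G x - m) * deriv \<phi> x) = 0"
    by (simp add: left_diff_distrib integral_unique)
  \<comment> \<open>A continuous nonnegative function with integral 0 vanishes identically. The
    point d + h / 2 is the centre of the step at d, where both factors turn out to be
    positive.\<close>
  then have "(G (d + h / 2) - m) * deriv \<phi> (d + h / 2) = 0"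
    using integral_eq_0_iff[OF cont'] nonneg c d h by auto
  moreover have "G (d + h / 2) > m"
    using h by (intro s(2)) (auto simp: dist_real_def)
  moreover have "deriv \<phi> (d + h / 2) > 0"
    using h \<open>G (d + h / 2) > m\<close> smooth_step'_pos[of "1 / 2"] by (simp add: d\<phi> sc)
  ultimately show False by simp
qed

text \<open>Excluding a strict inequality in both orders forces G to agree at any two interior
  points; continuity carries the constant to the endpoints.\<close>

lemma du_Bois_Reymond:
  assumes "a < b" and G: "continuous_on {a..b} G"
    and orth: "\<And>\<phi>. \<phi> \<in> test_functions a b \<Longrightarrow> integral {a..b} (\<lambda>x. G x * deriv \<phi> x) = 0"
    and x: "x \<in> {a..b}"
  shows "G x = G a"
proof -
  define m where "m = G ((a + b) / 2)"
  have "G y = m" if "y \<in> {a<..<b}" for y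
    using du_Bois_Reymond_not_less[OF G orth, of y "(a + b) / 2"]
      du_Bois_Reymond_not_less[OF G orth, of "(a + b) / 2" y] that \<open>a < b\<close>
    by (auto simp: m_def)
  then have "G y = m" if "y \<in> closure {a<..<b}" for y
    using continuous_constant_on_closure[of "{a<..<b}" G m y] that \<open>a < b\<close> G by simp
  then show ?thesis
    using x \<open>a < b\<close> by simp
qed

section \<open>The norm of the distributional derivative\<close>

text \<open>By compactness the maximum is attained, so \<open>GREATEST\<close> denotes an actual
  value of h.\<close>

lemma maximum_on_ge:
  assumes "continuous_on {a..b} h" "x \<in> {a..b::real}"
  shows "h x \<le> maximum_on {a..b} h"
proof -
  obtain y where y: "y \<in> {a..b}" "\<And>z. z \<in> {a..b} \<Longrightarrow> h z \<le> h y"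
    using continuous_attains_sup[of "{a..b}" h] assms by (metis compact_Icc empty_iff)
  then have "maximum_on {a..b} h = h y"
    unfolding maximum_on_def by (intro Greatest_equality) auto
  then show ?thesis using y assms by simp
qed

text \<open>Allows a primitive to be normalised to vanish at a: the constant is integrated against
  the derivative of a test function and contributes 0.\<close>

lemma distr_deriv_diff_const:
  assumes "a \<le> b" "continuous_on {a..b} F" "\<phi> \<in> test_functions a b"
  shows "distr_deriv a b (\<lambda>x. F x - c) \<phi> = distr_deriv a b F \<phi>"
proof -
  have "(\<lambda>x. F x * deriv \<phi> x) integrable_on {a..b}"
    using assms by (intro integrable_continuous_real continuous_intros continuous_on_deriv_test_function)
  then have "((\<lambda>x. F x * deriv \<phi> x - c * deriv \<phi> x) has_integral
      integral {a..b} (\<lambda>x. F x * deriv \<phi> x) - c * 0) {a..b}"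
    using assms
    by (intro has_integral_diff has_integral_mult_right test_function_integral_deriv)
      (auto simp: has_integral_integral)
  then show ?thesis
    by (simp add: distr_deriv_def left_diff_distrib integral_unique)
qed

text \<open>The difference F - H is orthogonal to all derivatives of test functions, hence constant
  by \<open>du_Bois_Reymond\<close>, and its value at a is 0.\<close>

lemma is_primitive_unique:
  assumes "a < b" "is_primitive a b F g" "is_primitive a b H g" "x \<in> {a..b}"
  shows "F x = H x"
proof -
  have F: "continuous_on {a..b} F" "F a = 0" and H: "continuous_on {a..b} H" "H a = 0"
    using assms by (auto simp: is_primitive_def)
  have "integral {a..b} (\<lambda>x. (F x - H x) * deriv \<phi> x) = 0" if \<phi>: "\<phi> \<in> test_functions a b" for \<phi>
  proof -
    have "(\<lambda>x. F x * deriv \<phi> x) integrable_on {a..b}" "(\<lambda>x. H x * deriv \<phi> x) integrable_on {a..b}"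
      using F H \<phi>
      by (intro integrable_continuous_real continuous_on_mult continuous_on_deriv_test_function;
          simp)+
    moreover have "integral {a..b} (\<lambda>x. F x * deriv \<phi> x) = integral {a..b} (\<lambda>x. H x * deriv \<phi> x)"
      using assms(2,3)[unfolded is_primitive_def, THEN conjunct2, THEN conjunct2, rule_format, OF \<phi>]
      by (simp add: distr_deriv_def)
    ultimately show ?thesis
      by (simp add: left_diff_distrib integral_diff)
  qed
  from du_Bois_Reymond[OF \<open>a < b\<close> _ this \<open>x \<in> {a..b}\<close>] F H show ?thesis
    by (simp add: continuous_on_diff)
qed

lemma alexiewicz_norm_distr_deriv:
  assumes "a < b" "continuous_on {a..b} F"
  shows "alexiewicz_norm_distr a b (distr_deriv a b F) = maximum_on {a..b} (\<lambda>x. \<bar>F x - F a\<bar>)"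
  unfolding alexiewicz_norm_distr_def
proof (rule the_equality)
  have prim: "is_primitive a b (\<lambda>x. F x - F a) (distr_deriv a b F)"
    using assms by (simp add: is_primitive_def distr_deriv_diff_const continuous_on_diff)
  then show "\<exists>H. is_primitive a b H (distr_deriv a b F) \<and>
      maximum_on {a..b} (\<lambda>x. \<bar>F x - F a\<bar>) = maximum_on {a..b} (\<lambda>x. \<bar>H x\<bar>)"
    by blast
  fix r assume "\<exists>H. is_primitive a b H (distr_deriv a b F) \<and> r = maximum_on {a..b} (\<lambda>x. \<bar>H x\<bar>)"
  then obtain H where H: "is_primitive a b H (distr_deriv a b F)" "r = maximum_on {a..b} (\<lambda>x. \<bar>H x\<bar>)"
    by blast
  \<comment> \<open>Primitives are determined only on \<open>{a..b}\<close>, but the maximum depends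
    only on the image of that interval.\<close>
  have "(\<lambda>x. \<bar>H x\<bar>) ` {a..b} = (\<lambda>x. \<bar>F x - F a\<bar>) ` {a..b}"
    using is_primitive_unique[OF \<open>a < b\<close> H(1) prim] by (intro image_cong) auto
  then show "r = maximum_on {a..b} (\<lambda>x. \<bar>F x - F a\<bar>)"
    by (simp add: H(2) maximum_on_def)
qed

section \<open>The estimate of the remainder\<close>

lemma nth_deriv_on_has_vector_derivative:
  assumes "nth_deriv_exists_on a b n f" "k < n" "x \<in> {a..b}"
  shows "(nth_deriv_on a b k f has_vector_derivative nth_deriv_on a b (Suc k) f x) (at x within {a..b})"
proof -
  have "nth_deriv_on a b k f differentiable (at x within {a..b})"
    using assms unfolding nth_deriv_exists_on_def differentiable_on_def by blast
  then show ?thesis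
    by (subst (asm) vector_derivative_works) simp
qed

lemma has_integral_power_diff:
  fixes a x :: real
  assumes "a \<le> x"
  shows "((\<lambda>t. (t - a) ^ m / fact m) has_integral (x - a) ^ Suc m / fact (Suc m)) {a..x}"
proof -
  have "((\<lambda>t. (t - a) ^ Suc m / fact (Suc m)) has_real_derivative (t - a) ^ m / fact m)
      (at t within {a..x})" for t
    by (rule DERIV_cong[OF DERIV_cdivide[OF DERIV_power[OF DERIV_diff[OF DERIV_ident DERIV_const]]]])
      simp
  then have "((\<lambda>t. (t - a) ^ m / fact m) has_integral
      (x - a) ^ Suc m / fact (Suc m) - (a - a) ^ Suc m / fact (Suc m)) {a..x}"
    by (intro fundamental_theorem_of_calculus assms)
      (simp only: has_real_derivative_iff_has_vector_derivative)
  then show ?thesis by simp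
qed

text \<open>The total mass of the Taylor kernel. It yields both the top-order term of the Taylor
  polynomial and the bound on the remainder.\<close>

lemma has_integral_power_diff':
  fixes a x :: real
  assumes "a \<le> x"
  shows "((\<lambda>t. (x - t) ^ m / fact m) has_integral (x - a) ^ Suc m / fact (Suc m)) {a..x}"
proof -
  have "((\<lambda>t. - ((x - t) ^ Suc m / fact (Suc m))) has_real_derivative (x - t) ^ m / fact m)
      (at t within {a..x})" for t
    by (rule DERIV_cong[OF DERIV_minus[OF DERIV_cdivide[OF
          DERIV_power[OF DERIV_diff[OF DERIV_const DERIV_ident]]]]])
      simp
  then have "((\<lambda>t. (x - t) ^ m / fact m) has_integral
      - ((x - x) ^ Suc m / fact (Suc m)) - - ((x - a) ^ Suc m / fact (Suc m))) {a..x}"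
    by (intro fundamental_theorem_of_calculus assms)
      (simp only: has_real_derivative_iff_has_vector_derivative)
  then show ?thesis by simp
qed

text \<open>The classical integral form expands only up to degree m, with f^(m+1) in the integrand.
  Subtracting the constant f^(m+1)(a) there removes exactly the term of degree m + 1, so that no
  derivative of f^(m+1) enters.\<close>

lemma taylor_remainder_has_integral:
  assumes "nth_deriv_exists_on a b (Suc m) f" "x \<in> {a..b}"
  shows "((\<lambda>t. (x - t) ^ m / fact m * (nth_deriv_on a b (Suc m) f t - nth_deriv_on a b (Suc m) f a))
    has_integral taylor_remainder a b (Suc m) f x) {a..x}"
proof -
  let ?D = "\<lambda>k. nth_deriv_on a b k f"
  have "((\<lambda>t. ((x - t) ^ (Suc m - 1) / fact (Suc m - 1)) *\<^sub>R ?D (Suc m) t) has_integral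
      f x - (\<Sum>i<Suc m. ((x - a) ^ i / fact i) *\<^sub>R ?D i a)) {a..x}"
  proof (rule Taylor_has_integral)
    show "(?D k has_vector_derivative ?D (Suc k) t) (at t within {a..x})"
      if "k < Suc m" "a \<le> t" "t \<le> x" for k t
      using nth_deriv_on_has_vector_derivative[OF assms(1), of k t] that assms(2)
      by (auto intro: has_vector_derivative_within_subset)
  qed (use assms in auto)
  moreover have "((\<lambda>t. (x - t) ^ m / fact m * ?D (Suc m) a) has_integral
      (x - a) ^ Suc m / fact (Suc m) * ?D (Suc m) a) {a..x}"
    using assms by (intro has_integral_mult_left has_integral_power_diff') auto
  ultimately have "((\<lambda>t. ((x - t) ^ (Suc m - 1) / fact (Suc m - 1)) *\<^sub>R ?D (Suc m) t
        - (x - t) ^ m / fact m * ?D (Suc m) a) has_integral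
      (f x - (\<Sum>i<Suc m. ((x - a) ^ i / fact i) *\<^sub>R ?D i a))
        - (x - a) ^ Suc m / fact (Suc m) * ?D (Suc m) a) {a..x}"
    by (rule has_integral_diff)
  moreover have "(f x - (\<Sum>i<Suc m. ((x - a) ^ i / fact i) *\<^sub>R ?D i a))
      - (x - a) ^ Suc m / fact (Suc m) * ?D (Suc m) a = taylor_remainder a b (Suc m) f x"
    unfolding taylor_remainder_def taylor_poly_def atLeast0AtMost lessThan_Suc_atMost sum.atMost_Suc
    by (simp add: mult.commute)
  ultimately show ?thesis
    by (simp add: right_diff_distrib del: nth_deriv_on.simps)
qed

text \<open>The kernel is nonnegative on \<open>{a..x}\<close>, so the other factor can be replaced
  by M and the kernel integrated.\<close>

lemma abs_taylor_remainder_le: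
  assumes "nth_deriv_exists_on a b (Suc m) f" "x \<in> {a..b}"
    and M: "\<And>t. t \<in> {a..b} \<Longrightarrow> \<bar>nth_deriv_on a b (Suc m) f t - nth_deriv_on a b (Suc m) f a\<bar> \<le> M"
  shows "\<bar>taylor_remainder a b (Suc m) f x\<bar> \<le> (x - a) ^ Suc m / fact (Suc m) * M"
proof -
  have int: "((\<lambda>t. (x - t) ^ m / fact m * M) has_integral (x - a) ^ Suc m / fact (Suc m) * M) {a..x}"
    using assms by (intro has_integral_mult_left has_integral_power_diff') auto
  note R = taylor_remainder_has_integral[OF assms(1,2)]
  have "norm (integral {a..x} (\<lambda>t. (x - t) ^ m / fact m *
      (nth_deriv_on a b (Suc m) f t - nth_deriv_on a b (Suc m) f a)))
    \<le> integral {a..x} (\<lambda>t. (x - t) ^ m / fact m * M)"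
    using M assms(2)
    by (intro integral_norm_bound_integral has_integral_integrable[OF R] has_integral_integrable[OF int])
      (auto simp: abs_mult divide_simps simp del: nth_deriv_on.simps intro!: mult_left_mono)
  then show ?thesis
    unfolding integral_unique[OF R] integral_unique[OF int] real_norm_def .
qed

lemma alexiewicz_norm_taylor_remainder_le:
  assumes "a \<le> b" "nth_deriv_exists_on a b (Suc m) f"
    and M: "\<And>t. t \<in> {a..b} \<Longrightarrow> \<bar>nth_deriv_on a b (Suc m) f t - nth_deriv_on a b (Suc m) f a\<bar> \<le> M"
  shows "alexiewicz_norm a b (taylor_remainder a b (Suc m) f) \<le> (b - a) ^ (m + 2) / fact (m + 2) * M"
  unfolding alexiewicz_norm_def
proof (rule cSUP_least)
  fix x assume x: "x \<in> {a..b}"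
  \<comment> \<open>The case t = a of the bound; the sign is needed when x is finally enlarged to
    b.\<close>
  have "M \<ge> 0" using M[of a] assms(1) by simp
  have int: "((\<lambda>t. (t - a) ^ Suc m / fact (Suc m) * M) has_integral
      (x - a) ^ Suc (Suc m) / fact (Suc (Suc m)) * M) {a..x}"
    using x by (intro has_integral_mult_left has_integral_power_diff) auto
  have "nth_deriv_on a b 0 f differentiable_on {a..b}"
    using assms(2) unfolding nth_deriv_exists_on_def by blast
  then have "continuous_on {a..x} f"
    using x by (auto dest!: differentiable_imp_continuous_on intro: continuous_on_subset)
  then have "taylor_remainder a b (Suc m) f integrable_on {a..x}"
    unfolding taylor_remainder_def taylor_poly_def
    by (intro integrable_continuous_real continuous_intros) auto
  \<comment> \<open>Integrating the pointwise bound once more raises the exponent from m + 1 to m +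
    2, which is n + 1 in the theorem.\<close>
  then have "norm (integral {a..x} (taylor_remainder a b (Suc m) f))
      \<le> integral {a..x} (\<lambda>t. (t - a) ^ Suc m / fact (Suc m) * M)"
    using abs_taylor_remainder_le[OF assms(2) _ M] x
    by (intro integral_norm_bound_integral has_integral_integrable[OF int]) auto
  also have "\<dots> = (x - a) ^ (m + 2) / fact (m + 2) * M"
    using integral_unique[OF int] by (simp only: add_2_eq_Suc')
  also have "\<dots> \<le> (b - a) ^ (m + 2) / fact (m + 2) * M"
    using x \<open>M \<ge> 0\<close> by (intro mult_right_mono divide_right_mono power_mono) auto
  finally show "\<bar>integral {a..x} (taylor_remainder a b (Suc m) f)\<bar> \<le> \<dots>" by simp
qed (use assms in auto)

theorem theorem6:
  fixes a b :: real and n :: nat and f :: "real \<Rightarrow> real"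
  assumes "a < b"
    and "n > 0"
    and "nth_deriv_exists_on a b n f"
    and "continuous_on {a..b} (nth_deriv_on a b n f)"
  shows "alexiewicz_norm a b (taylor_remainder a b n f)
           \<le> (b - a) ^ (n + 1) / fact (n + 1)
               * alexiewicz_norm_distr a b (distr_deriv a b (nth_deriv_on a b n f))
       \<and> (b - a) ^ (n + 1) / fact (n + 1)
               * alexiewicz_norm_distr a b (distr_deriv a b (nth_deriv_on a b n f))
           = (b - a) ^ (n + 1) / fact (n + 1)
               * maximum_on {a..b} (\<lambda>x. \<bar>nth_deriv_on a b n f x - nth_deriv_on a b n f a\<bar>)"
proof -
  \<comment> \<open>The Taylor kernel has exponent n - 1, hence the shift to m.\<close>
  obtain m where n: "n = Suc m" using \<open>n > 0\<close> gr0_implies_Suc by blast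
  have "\<bar>nth_deriv_on a b n f t - nth_deriv_on a b n f a\<bar>
      \<le> maximum_on {a..b} (\<lambda>x. \<bar>nth_deriv_on a b n f x - nth_deriv_on a b n f a\<bar>)"
    if "t \<in> {a..b}" for t
    using maximum_on_ge[of a b "\<lambda>x. \<bar>nth_deriv_on a b n f x - nth_deriv_on a b n f a\<bar>" t] that assms(4)
    by (simp add: continuous_on_diff continuous_on_rabs)
  from alexiewicz_norm_taylor_remainder_le[OF less_imp_le[OF \<open>a < b\<close>] assms(3)[unfolded n] this[unfolded n]]
  show ?thesis
    unfolding alexiewicz_norm_distr_deriv[OF assms(1,4)] by (simp add: n del: nth_deriv_on.simps)
qed

end
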